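(* For every $n\ge1$ the Eastwood-Ezhov polynomial $\Phi_n$ is related to the characteristic polynomial $P_n$ of the Cayley algebra $(\mathbb{C}_n,\star)$ by $$P_n-1=-n\Phi_n .$$ As a consequence the polynomials $\Phi_n$ satisfy the recursion $$\Phi_n(x_1,\dots,x_n)=-x_n+\sum_{i=1}^{n-1}\left(\tfrac{i}{n}-1\right)x_i\,\Phi_{n-i}(x_1,\dots,x_{n-i}),$$ where $\Phi_1(x)=-x$.
   Context: The Eastwood-Ezhov polynomials are $$\Phi_n(x_1,\dots,x_n)=\sum_{i=1}^n(-1)^i\frac1i\sum_{j_1+\dots+j_i=n}x_{j_1}\cdots x_{j_i},$$ the inner sum being over ordered $i$-tuples of positive integers with sum $n$. The Cayley algebra $(\mathbb{C}_n,\star)$ is the $n$-dimensional real vector space with basis $e_1,\dots,e_n$ and multiplication, for $x=\sum x_ie_i$, $y=\sum y_ie_i$, $$x\star y=\sum_{i=1}^n\Big(i\,x_ny_i+\sum_{1\le j<i}x_{i-j}y_j\Big)e_i .$$ With $R(x)y=y\star x$, its characteristic polynomial is $P_n(x_1,\dots,x_n)=\det(I+R(x))$. Here $R(x)$ is the $n\times n$ matrix whose $(i,j)$ entry is $x_{i-j}$ for $1\le j<i\le n$, plus $i x_i$ added to the $(i,n)$ entry for each $i$, all other entries being zero. *)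

theory Defs
  imports Complex_Main "Jordan_Normal_Form.Determinant"
begin

text \<open>Polynomials in \<open>x\<^sub>1, x\<^sub>2, \<dots>\<close> with real coefficients are represented by the functions they
  define on real sequences \<open>x\<close>, with \<open>x i\<close> for \<open>x\<^sub>i\<close>; the value \<open>x 0\<close> is never used.\<close>

definition compositions :: "nat \<Rightarrow> nat \<Rightarrow> nat list set" where
  "compositions i n = {js. length js = i \<and> (\<forall>j\<in>set js. 1 \<le> j) \<and> sum_list js = n}"

definition EE_poly :: "nat \<Rightarrow> (nat \<Rightarrow> real) \<Rightarrow> real" where
  "EE_poly n x =
     (\<Sum>i=1..n. (-1) ^ i * (1 / real i) * (\<Sum>js\<in>compositions i n. \<Prod>j\<leftarrow>js. x j))"

text \<open>The Cayley algebra has carrier \<^term>\<open>carrier_vec n :: real vec set\<close>. Vector indices start at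
  \<open>0\<close>, so the coordinate with respect to \<open>e\<^sub>i\<close> is found at index \<open>i - 1\<close>, and \<open>e\<^sub>i\<close> is
  \<^term>\<open>unit_vec n (i - 1)\<close>. In the definition, \<open>i = k + 1\<close>.\<close>

definition coord :: "real vec \<Rightarrow> nat \<Rightarrow> real" where
  "coord x i = x $ (i - 1)"

definition cayley_mult :: "nat \<Rightarrow> real vec \<Rightarrow> real vec \<Rightarrow> real vec" where
  "cayley_mult n x y = vec n (\<lambda>k. let i = k + 1 in
     real i * coord x n * coord y i + (\<Sum>j\<in>{1..<i}. coord x (i - j) * coord y j))"

text \<open>The matrix of the right multiplication \<open>y \<mapsto> y \<star> x\<close> in the basis \<open>e\<^sub>1, \<dots>, e\<^sub>n\<close>: column \<open>j\<close>
  holds the coordinates of \<open>e\<^sub>j \<star> x\<close>.\<close>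

definition cayley_R :: "nat \<Rightarrow> real vec \<Rightarrow> real mat" where
  "cayley_R n x = mat n n (\<lambda>(r, c). cayley_mult n (unit_vec n c) x $ r)"

definition cayley_char_poly :: "nat \<Rightarrow> (nat \<Rightarrow> real) \<Rightarrow> real" where
  "cayley_char_poly n x = det (1\<^sub>m n + cayley_R n (vec n (\<lambda>k. x (k + 1))))"

lemma finite_compositions: "finite (compositions i n)"
proof (rule finite_subset)
  show "compositions i n \<subseteq> {js. set js \<subseteq> {..n} \<and> length js = i}"
    using member_le_sum_list by (fastforce simp: compositions_def)
  show "finite {js. set js \<subseteq> {..n} \<and> length js = i}"
    by (rule finite_lists_length_eq) simp
qed

lemma EE_poly_cong:
  assumes "\<And>i. 1 \<le> i \<Longrightarrow> i \<le> n \<Longrightarrow> x i = y i"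
  shows "EE_poly n x = EE_poly n y"
proof -
  have "(\<Prod>j\<leftarrow>js. x j) = (\<Prod>j\<leftarrow>js. y j)" if "js \<in> compositions i n" for i js
  proof -
    have "x j = y j" if "j \<in> set js" for j
      using that \<open>js \<in> compositions i n\<close> member_le_sum_list[OF that] assms
      by (simp add: compositions_def)
    then show ?thesis
      by (metis map_eq_conv)
  qed
  then show ?thesis
    unfolding EE_poly_def by simp
qed

lemma cayley_R_index:
  assumes "1 \<le> i" "i \<le> n" "1 \<le> j" "j \<le> n"
  shows "cayley_R n x $$ (i - 1, j - 1) =
    (if j < i then coord x (i - j) else 0) + (if j = n then real i * coord x i else 0)"
proof -
  have "(\<Sum>m\<in>{1..<i}. coord (unit_vec n (j - 1)) (i - m) * coord x m) =
        (\<Sum>m\<in>{1..<i}. if m = i - j then coord x (i - j) else 0)"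
    using assms by (intro sum.cong) (auto simp: coord_def)
  also have "\<dots> = (if j < i then coord x (i - j) else 0)"
    using assms by (subst sum.delta) auto
  finally have *: "(\<Sum>m\<in>{1..<i}. coord (unit_vec n (j - 1)) (i - m) * coord x m) =
      (if j < i then coord x (i - j) else 0)" .
  have "coord (unit_vec n (j - 1)) n = (if j = n then 1 else 0)"
    using assms by (auto simp: coord_def)
  with * show ?thesis
    using assms unfolding cayley_R_def cayley_mult_def Let_def by (simp del: sum.op_ivl_Suc)
qed

lemma cayley_R_mult_vec:
  assumes "y \<in> carrier_vec n"
  shows "cayley_R n x *\<^sub>v y = cayley_mult n y x"
proof (rule eq_vecI)
  fix k assume "k < dim_vec (cayley_mult n y x)"
  then have k: "k < n" by (simp add: cayley_mult_def)
  define f where "f c = (if c < k then coord x (k - c) * y $ c else 0)" for c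
  have "(cayley_R n x *\<^sub>v y) $ k = (\<Sum>c<n. cayley_R n x $$ (k, c) * y $ c)"
    using k assms by (simp add: scalar_prod_def cayley_R_def atLeast0LessThan)
  also have "\<dots> = (\<Sum>c<n. f c + (if c = n - 1 then real (k + 1) * coord x (k + 1) * y $ c else 0))"
  proof (rule sum.cong)
    fix c assume "c \<in> {..<n}"
    then show "cayley_R n x $$ (k, c) * y $ c =
        f c + (if c = n - 1 then real (k + 1) * coord x (k + 1) * y $ c else 0)"
      using cayley_R_index[of "k + 1" n "c + 1" x] k by (auto simp: f_def algebra_simps)
  qed simp
  also have "\<dots> = (\<Sum>c<n. f c) + real (k + 1) * coord x (k + 1) * y $ (n - 1)"
    using k by (simp add: sum.distrib)
  also have "(\<Sum>c<n. f c) = (\<Sum>c<k. coord x (k - c) * y $ c)"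
    using k unfolding f_def by (intro sum.mono_neutral_cong_right) auto
  also have "\<dots> = (\<Sum>m\<in>{1..<k + 1}. coord y (k + 1 - m) * coord x m)"
    by (rule sum.reindex_bij_witness[where i = "\<lambda>m. k - m" and j = "\<lambda>c. k - c"])
      (auto simp: coord_def)
  finally show "(cayley_R n x *\<^sub>v y) $ k = cayley_mult n y x $ k"
    using k by (simp add: cayley_mult_def coord_def algebra_simps)
qed (simp add: cayley_mult_def cayley_R_def)

end

theory Submission
  imports Defs "HOL-Computational_Algebra.Formal_Power_Series"
begin

text \<open>Put \<open>X(t) = \<Sum>\<^sub>i\<^sub>\<ge>\<^sub>1 x\<^sub>i t\<^sup>i\<close>. The inner sum in the definition of \<open>\<Phi>\<^sub>n\<close> is the coefficient of
  \<open>t\<^sup>n\<close> in \<open>X\<^sup>i\<close>, so the generating function of the \<open>\<Phi>\<^sub>n\<close> is \<open>- ln (1 + X)\<close>. The Euler derivation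
  \<open>t d/dt\<close> turns the logarithm into the identity
  \<open>(1 + X) \<sqdot> \<Sum>\<^sub>n n \<Phi>\<^sub>n t\<^sup>n = - \<Sum>\<^sub>n n x\<^sub>n t\<^sup>n\<close>,
  whose coefficients are the recursion (lemma \<open>EE_poly_convolution\<close>).

  The same identity computes the determinant. Multiplication by \<open>1 + X\<close> on coefficient vectors is
  the unit lower triangular Toeplitz matrix \<open>L\<close>, and \<open>I + R(x) = L + u e\<^sub>n\<^sup>T\<close> with \<open>u\<^sub>i = i x\<^sub>i\<close>.
  The identity says \<open>L z = u\<close> for \<open>z\<^sub>i = - i \<Phi>\<^sub>i\<close>, so \<open>I + R(x) = L (I + z e\<^sub>n\<^sup>T)\<close>. Both factors
  are triangular, and the only diagonal entry that can differ from \<open>1\<close> is the last one of the second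
  factor, which is \<open>1 + z\<^sub>n = 1 - n \<Phi>\<^sub>n\<close>.\<close>

definition var_fps :: "(nat \<Rightarrow> real) \<Rightarrow> real fps" where
  "var_fps x = Abs_fps (\<lambda>n. if n = 0 then 0 else x n)"

lemma var_fps_nth [simp]: "fps_nth (var_fps x) n = (if n = 0 then 0 else x n)"
  by (simp add: var_fps_def)

text \<open>The \<open>i\<close>-th power of a series sums over all \<open>i\<close>-tuples of naturals; tuples with an entry \<open>0\<close>
  drop out because the constant coefficient vanishes.\<close>

lemma var_fps_power_nth:
  "fps_nth (var_fps x ^ i) n = (\<Sum>js\<in>compositions i n. \<Prod>j\<leftarrow>js. x j)"
proof -
  have list_prod: "(\<Prod>k<length js. f (js ! k)) = (\<Prod>j\<leftarrow>js. f j)" for js :: "nat list" and f :: "nat \<Rightarrow> real"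
    by (simp add: prod.list_conv_set_nth atLeast0LessThan)
  have "fps_nth (var_fps x ^ i) n =
      (\<Sum>js\<in>natpermute n i. \<Prod>j\<leftarrow>js. fps_nth (var_fps x) j)"
  proof (cases i)
    case 0
    then show ?thesis by (auto simp: natpermute_0)
  next
    case (Suc m)
    have "(\<Prod>k\<in>{0..m}. fps_nth (var_fps x) (js ! k)) = (\<Prod>j\<leftarrow>js. fps_nth (var_fps x) j)"
      if "js \<in> natpermute n (Suc m)" for js
      using that list_prod[of "fps_nth (var_fps x)" js]
      by (simp add: natpermute_def atLeast0AtMost lessThan_Suc_atMost del: var_fps_nth)
    then show ?thesis
      unfolding Suc fps_power_nth by (simp del: var_fps_nth)
  qed
  also have "\<dots> = (\<Sum>js\<in>compositions i n. \<Prod>j\<leftarrow>js. fps_nth (var_fps x) j)"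
  proof (rule sum.mono_neutral_right)
    show "compositions i n \<subseteq> natpermute n i"
      by (auto simp: compositions_def natpermute_def)
    show "\<forall>js\<in>natpermute n i - compositions i n. (\<Prod>j\<leftarrow>js. fps_nth (var_fps x) j) = 0"
      by (auto simp: compositions_def natpermute_def prod_list_zero_iff Suc_le_eq image_iff)
  qed (rule natpermute_finite)
  also have "\<dots> = (\<Sum>js\<in>compositions i n. \<Prod>j\<leftarrow>js. x j)"
    by (intro sum.cong refl arg_cong[of _ _ prod_list] map_cong) (auto simp: compositions_def)
  finally show ?thesis .
qed

text \<open>Composition with \<open>X\<close> only involves the powers \<open>X\<^sup>i\<close> with \<open>i \<le> n\<close> in the coefficient of \<open>t\<^sup>n\<close>,
  which matches the range of \<open>i\<close> in \<open>\<Phi>\<^sub>n\<close>; the weights \<open>(-1)\<^sup>i / i\<close> are the coefficients of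
  \<open>- ln (1 + t)\<close>.\<close>

lemma EE_poly_eq_ln_nth: "EE_poly n x = - fps_nth (fps_compose (fps_ln 1) (var_fps x)) n"
proof -
  have "fps_nth (fps_compose (fps_ln 1) (var_fps x)) n =
      (\<Sum>i\<in>{0..n}. fps_nth (fps_ln 1) i * fps_nth (var_fps x ^ i) n)"
    by (simp add: fps_compose_nth)
  also have "\<dots> = (\<Sum>i=1..n. fps_nth (fps_ln 1) i * fps_nth (var_fps x ^ i) n)"
    by (rule sum.mono_neutral_right) (auto simp: fps_ln_nth Suc_le_eq)
  also have "\<dots> = - EE_poly n x"
    unfolding EE_poly_def var_fps_power_nth sum_negf[symmetric]
  proof (intro sum.cong refl)
    fix i assume "i \<in> {1..n}"
    then obtain m where "i = Suc m" by (cases i) auto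
    then show "fps_nth (fps_ln 1) i * (\<Sum>js\<in>compositions i n. \<Prod>j\<leftarrow>js. x j) =
        - ((-1) ^ i * (1 / real i) * (\<Sum>js\<in>compositions i n. \<Prod>j\<leftarrow>js. x j))"
      by (simp add: fps_ln_nth)
  qed
  finally show ?thesis by simp
qed

text \<open>The coefficient of \<open>t\<^sup>n\<close> in \<open>(1 + X) \<sqdot> t d/dt ln (1 + X) = t d/dt X\<close>.\<close>

lemma EE_poly_convolution:
  assumes "n \<ge> 1"
  shows "real n * EE_poly n x + (\<Sum>i=1..<n. x i * (real (n - i) * EE_poly (n - i) x)) =
    - (real n * x n)"
proof -
  let ?X = "var_fps x" and ?F = "fps_compose (fps_ln 1) (var_fps x)"
  have "fps_deriv ?F = inverse (1 + ?X) * fps_deriv ?X"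
    by (simp add: fps_compose_deriv fps_ln_deriv fps_inverse_compose fps_compose_add_distrib)
  then have "(1 + ?X) * fps_XD ?F = ((1 + ?X) * inverse (1 + ?X)) * fps_XD ?X"
    by (simp add: fps_XD_def mult_ac)
  also have "(1 + ?X) * inverse (1 + ?X) = 1"
    by (rule inverse_mult_eq_1') simp
  finally have euler: "(1 + ?X) * fps_XD ?F = fps_XD ?X"
    by simp
  have "real n * x n = fps_nth ((1 + ?X) * fps_XD ?F) n"
    unfolding euler using assms by (simp add: fps_XD_def)
  also have "\<dots> = fps_nth (fps_XD ?F) n + fps_nth (?X * fps_XD ?F) n"
    by (simp add: distrib_right)
  also have "fps_nth (?X * fps_XD ?F) n = (\<Sum>i\<in>{0..n}. fps_nth ?X i * fps_nth (fps_XD ?F) (n - i))"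
    by (simp add: fps_mult_nth)
  also have "\<dots> = (\<Sum>i=1..<n. fps_nth ?X i * fps_nth (fps_XD ?F) (n - i))"
    by (rule sum.mono_neutral_right) (auto simp: fps_XD_def)
  also have "\<dots> = - (\<Sum>i=1..<n. x i * (real (n - i) * EE_poly (n - i) x))"
    unfolding sum_negf[symmetric]
    by (intro sum.cong) (auto simp: EE_poly_eq_ln_nth fps_XD_def Suc_diff_Suc)
  also have "fps_nth (fps_XD ?F) n = - (real n * EE_poly n x)"
    by (simp add: EE_poly_eq_ln_nth fps_XD_def)
  finally show ?thesis by simp
qed

lemma EE_poly_recursion:
  assumes "n \<ge> 1"
  shows "EE_poly n x = - x n + (\<Sum>i=1..n-1. (real i / real n - 1) * x i * EE_poly (n - i) x)"
proof -
  have "real n * (\<Sum>i=1..n-1. (real i / real n - 1) * x i * EE_poly (n - i) x) =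
      - (\<Sum>i=1..<n. x i * (real (n - i) * EE_poly (n - i) x))"
    unfolding sum_distrib_left sum_negf[symmetric]
    using assms by (intro sum.cong) (auto simp: field_simps of_nat_diff)
  with EE_poly_convolution[OF assms, of x]
  have "real n * EE_poly n x =
      real n * (- x n + (\<Sum>i=1..n-1. (real i / real n - 1) * x i * EE_poly (n - i) x))"
    unfolding distrib_left by linarith
  with assms show ?thesis
    by simp
qed

definition toeplitz_mat :: "nat \<Rightarrow> (nat \<Rightarrow> real) \<Rightarrow> real mat" where
  "toeplitz_mat n x = mat n n (\<lambda>(r, c). if c < r then x (r - c) else if c = r then 1 else 0)"

definition last_column_mat :: "nat \<Rightarrow> (nat \<Rightarrow> real) \<Rightarrow> real mat" where
  "last_column_mat n z =
     mat n n (\<lambda>(r, c). (if r = c then 1 else 0) + (if c = n - 1 then z (r + 1) else 0))"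

lemma det_toeplitz_mat: "det (toeplitz_mat n x) = 1"
proof -
  have "det (toeplitz_mat n x) = prod_list (diag_mat (toeplitz_mat n x))"
    by (rule det_lower_triangular[of n]) (auto simp: toeplitz_mat_def)
  also have "\<dots> = 1"
    by (simp add: prod_list_diag_prod toeplitz_mat_def)
  finally show ?thesis .
qed

lemma det_last_column_mat:
  assumes "n \<ge> 1"
  shows "det (last_column_mat n z) = 1 + z n"
proof -
  obtain m where n: "n = Suc m" using assms by (cases n) auto
  have "det (last_column_mat n z) = prod_list (diag_mat (last_column_mat n z))"
    by (rule det_upper_triangular[of _ n]) (auto simp: last_column_mat_def)
  also have "\<dots> = 1 + z n"
    by (simp add: prod_list_diag_prod last_column_mat_def n)
  finally show ?thesis .
qed

text \<open>The hypothesis is \<open>L z = u\<close> in coordinates; it moves the rank one term \<open>u e\<^sub>n\<^sup>T\<close> of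
  \<open>I + R(x)\<close> behind \<open>L\<close>.\<close>

lemma one_plus_cayley_R_factorization:
  assumes z: "\<And>k. 1 \<le> k \<Longrightarrow> k \<le> n \<Longrightarrow> z k + (\<Sum>i=1..<k. x i * z (k - i)) = real k * x k"
  shows "1\<^sub>m n + cayley_R n (vec n (\<lambda>k. x (k + 1))) = toeplitz_mat n x * last_column_mat n z"
proof (rule eq_matI)
  fix r c
  assume "r < dim_row (toeplitz_mat n x * last_column_mat n z)"
    and "c < dim_col (toeplitz_mat n x * last_column_mat n z)"
  then have r: "r < n" and c: "c < n"
    by (auto simp: toeplitz_mat_def last_column_mat_def)
  let ?L = "\<lambda>m. if m < r then x (r - m) else if m = r then 1 else 0"
  have "(\<Sum>m<n. ?L m * z (m + 1)) = (\<Sum>m<Suc r. ?L m * z (m + 1))"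
    using r by (intro sum.mono_neutral_right) auto
  also have "\<dots> = z (r + 1) + (\<Sum>m<r. x (r - m) * z (m + 1))"
    by simp
  also have "(\<Sum>m<r. x (r - m) * z (m + 1)) = (\<Sum>i=1..<r + 1. x i * z (r + 1 - i))"
    by (rule sum.reindex_bij_witness[where i = "\<lambda>i. r - i" and j = "\<lambda>m. r - m"]) auto
  also have "z (r + 1) + \<dots> = real (r + 1) * x (r + 1)"
    using r by (intro z) auto
  finally have Lz: "(\<Sum>m<n. ?L m * z (m + 1)) = real (r + 1) * x (r + 1)" .
  have "(toeplitz_mat n x * last_column_mat n z) $$ (r, c) =
      (\<Sum>m<n. ?L m * ((if m = c then 1 else 0) + (if c = n - 1 then z (m + 1) else 0)))"
    using r c by (simp add: toeplitz_mat_def last_column_mat_def scalar_prod_def atLeast0LessThan)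
  also have "\<dots> = (\<Sum>m<n. ?L m * (if m = c then 1 else 0)) +
      (if c = n - 1 then (\<Sum>m<n. ?L m * z (m + 1)) else 0)"
    by (simp only: distrib_left sum.distrib) simp
  also have "(\<Sum>m<n. ?L m * (if m = c then 1 else 0)) = (\<Sum>m<n. if m = c then ?L c else 0)"
    by (rule sum.cong) auto
  also have "\<dots> = ?L c"
    using c by simp
  finally have product: "(toeplitz_mat n x * last_column_mat n z) $$ (r, c) =
      ?L c + (if c = n - 1 then real (r + 1) * x (r + 1) else 0)"
    unfolding Lz .
  show "(1\<^sub>m n + cayley_R n (vec n (\<lambda>k. x (k + 1)))) $$ (r, c) =
      (toeplitz_mat n x * last_column_mat n z) $$ (r, c)"
    unfolding product
    using cayley_R_index[of "r + 1" n "c + 1" "vec n (\<lambda>k. x (k + 1))"] r c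
    by (auto simp: coord_def cayley_R_def Suc_diff_Suc)
qed (simp_all add: toeplitz_mat_def last_column_mat_def cayley_R_def)

theorem lemma7p5:
  fixes n :: nat and x :: "nat \<Rightarrow> real"
  assumes "n \<ge> 1"
  shows "cayley_char_poly n x - 1 = - real n * EE_poly n x \<and>
    EE_poly n x = - x n + (\<Sum>i=1..n-1. (real i / real n - 1) * x i * EE_poly (n - i) x) \<and>
    EE_poly 1 x = - x 1"
proof (intro conjI)
  let ?z = "\<lambda>k. - (real k * EE_poly k x)"
  have "?z k + (\<Sum>i=1..<k. x i * ?z (k - i)) = real k * x k" if "1 \<le> k" for k
    using EE_poly_convolution[OF that, of x] by (simp add: sum_negf)
  then have "cayley_char_poly n x = det (toeplitz_mat n x * last_column_mat n ?z)"
    unfolding cayley_char_poly_def by (subst one_plus_cayley_R_factorization) auto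
  also have "\<dots> = det (toeplitz_mat n x) * det (last_column_mat n ?z)"
    by (rule det_mult[of _ n]) (simp_all add: toeplitz_mat_def last_column_mat_def)
  also have "\<dots> = 1 - real n * EE_poly n x"
    by (simp add: det_toeplitz_mat det_last_column_mat[OF assms])
  finally show "cayley_char_poly n x - 1 = - real n * EE_poly n x"
    by simp
  show "EE_poly n x = - x n + (\<Sum>i=1..n-1. (real i / real n - 1) * x i * EE_poly (n - i) x)"
    using assms by (rule EE_poly_recursion)
  show "EE_poly 1 x = - x 1"
    using EE_poly_recursion[of 1 x] by simp
qed

end
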